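(* Let $(E,\mathcal{E})$ be a Lusin space. Let $L$ be a Markov operator on $\mathcal{L}^\infty(E)$ associated to a (homogeneous) Markov chain $(X_n)$. If $L$ is invertible in the category of Markov operators, i.e. there exists a Markov operator $M$ on $\mathcal{L}^\infty(E)$ such that $ML=LM=I$, then $(X_n)$ is deterministic.
   Context: A Lusin space is a measurable space isomorphic, as a measurable space, to a Borel subset of a compact metrizable space. $\mathcal{L}^\infty(E)$ is the space of bounded measurable complex-valued functions on $E$. A Markov kernel on $(E,\mathcal{E})$ is a map $\nu:E\times\mathcal{E}\to[0,1]$ measurable in the first variable and a probability measure in the second. A Markov operator is an operator on $\mathcal{L}^\infty(E)$ of the form $Lf(x)=\int_E f(y)\,\nu(x,dy)$ for a Markov kernel $\nu$. The operator $L$ is associated to the homogeneous Markov chain $(X_n)$ with transition kernel $\nu$: $\mathbb{E}[f(X_{n+1})\mid X_0,\dots,X_n]=Lf(X_n)$. The chain is called deterministic if its transition kernel $\nu$ is, i.e. for every $x\in E$ the measure $\nu(x,\cdot)$ is a Dirac mass; equivalently there is a measurable map $\widetilde T:E\to E$ with $\nu(x,dy)=\delta_{\widetilde T(x)}(dy)$ for all $x\in E$. *)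

theory Defs
  imports "HOL-Probability.Probability"
begin

text \<open>Measurable spaces are represented by the \<open>space\<close> and \<open>sets\<close> of an \<open>'a measure\<close>;
  the measure carried by such a value is irrelevant throughout.\<close>

definition topology_borel :: "'b topology \<Rightarrow> 'b measure" where
  "topology_borel K = sigma (topspace K) {U. openin K U}"

definition measurable_isomorphic :: "'a measure \<Rightarrow> 'b measure \<Rightarrow> bool" where
  "measurable_isomorphic E N \<longleftrightarrow>
     (\<exists>f \<in> E \<rightarrow>\<^sub>M N. \<exists>g \<in> N \<rightarrow>\<^sub>M E.
        (\<forall>x\<in>space E. g (f x) = x) \<and> (\<forall>y\<in>space N. f (g y) = y))"

text \<open>HOL cannot quantify existentially over the type of points of the compact metrizable
  space. That type is therefore a parameter: a statement assuming
  \<open>lusin_space TYPE('b) E\<close> with \<open>'b\<close> schematic covers every compact metrizable space.\<close>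

definition lusin_space :: "'b itself \<Rightarrow> 'a measure \<Rightarrow> bool" where
  "lusin_space _ E \<longleftrightarrow>
     (\<exists>(K :: 'b topology) B.
        compact_space K \<and> metrizable_space K \<and> B \<in> sets (topology_borel K) \<and>
        measurable_isomorphic E (restrict_space (topology_borel K) B))"

definition Linf :: "'a measure \<Rightarrow> ('a \<Rightarrow> complex) set" where
  "Linf E = {f \<in> borel_measurable E. bounded (f ` space E)}"

text \<open>Membership in \<open>E \<rightarrow>\<^sub>M prob_algebra E\<close> says that every \<open>\<nu> x\<close> is a
  probability measure on the sigma-algebra of \<open>E\<close> and that \<open>x \<mapsto> \<nu> x A\<close> is measurable
  for every measurable \<open>A\<close>.\<close>

definition markov_kernel :: "'a measure \<Rightarrow> ('a \<Rightarrow> 'a measure) \<Rightarrow> bool" where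
  "markov_kernel E \<nu> \<longleftrightarrow> \<nu> \<in> E \<rightarrow>\<^sub>M prob_algebra E"

text \<open>Elements of \<open>Linf E\<close> have unspecified values outside \<open>space E\<close>, so identities
  between them are pointwise identities on \<open>space E\<close>; operators are only constrained
  on \<open>Linf E\<close>.\<close>

definition markov_operator_of ::
    "'a measure \<Rightarrow> ('a \<Rightarrow> 'a measure) \<Rightarrow> (('a \<Rightarrow> complex) \<Rightarrow> ('a \<Rightarrow> complex)) \<Rightarrow> bool" where
  "markov_operator_of E \<nu> L \<longleftrightarrow>
     markov_kernel E \<nu> \<and> (\<forall>f\<in>Linf E. \<forall>x\<in>space E. L f x = (\<integral>y. f y \<partial>\<nu> x))"

definition markov_operator ::
    "'a measure \<Rightarrow> (('a \<Rightarrow> complex) \<Rightarrow> ('a \<Rightarrow> complex)) \<Rightarrow> bool" where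
  "markov_operator E L \<longleftrightarrow> (\<exists>\<nu>. markov_operator_of E \<nu> L)"

definition markov_invertible ::
    "'a measure \<Rightarrow> (('a \<Rightarrow> complex) \<Rightarrow> ('a \<Rightarrow> complex)) \<Rightarrow> bool" where
  "markov_invertible E L \<longleftrightarrow>
     (\<exists>M. markov_operator E M \<and>
        (\<forall>f\<in>Linf E. \<forall>x\<in>space E. M (L f) x = f x \<and> L (M f) x = f x))"

definition complex_cond_exp ::
    "'w measure \<Rightarrow> 'w measure \<Rightarrow> ('w \<Rightarrow> complex) \<Rightarrow> 'w \<Rightarrow> complex" where
  "complex_cond_exp P F g \<omega> =
     Complex (real_cond_exp P F (\<lambda>w. Re (g w)) \<omega>) (real_cond_exp P F (\<lambda>w. Im (g w)) \<omega>)"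

definition past_algebra ::
    "'w measure \<Rightarrow> 'a measure \<Rightarrow> (nat \<Rightarrow> 'w \<Rightarrow> 'a) \<Rightarrow> nat \<Rightarrow> 'w measure" where
  "past_algebra P E X n =
     sigma (space P) {X i -` A \<inter> space P | i A. i \<le> n \<and> A \<in> sets E}"

text \<open>The initial law of the chain is arbitrary. The transition kernel is part of the data of
  a chain, since the process alone determines it only almost surely.\<close>

definition markov_chain ::
    "'a measure \<Rightarrow> ('a \<Rightarrow> 'a measure) \<Rightarrow> 'w measure \<Rightarrow> (nat \<Rightarrow> 'w \<Rightarrow> 'a) \<Rightarrow> bool" where
  "markov_chain E \<nu> P X \<longleftrightarrow>
     markov_kernel E \<nu> \<and> prob_space P \<and> (\<forall>n. X n \<in> P \<rightarrow>\<^sub>M E) \<and>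
     (\<forall>n. \<forall>f\<in>Linf E. AE \<omega> in P.
        complex_cond_exp P (past_algebra P E X n) (\<lambda>w. f (X (Suc n) w)) \<omega>
          = (\<integral>y. f y \<partial>\<nu> (X n \<omega>)))"

definition deterministic_kernel :: "'a measure \<Rightarrow> ('a \<Rightarrow> 'a measure) \<Rightarrow> bool" where
  "deterministic_kernel E \<nu> \<longleftrightarrow> (\<forall>x\<in>space E. \<exists>y\<in>space E. \<nu> x = return E y)"

definition deterministic_chain ::
    "'a measure \<Rightarrow> ('a \<Rightarrow> 'a measure) \<Rightarrow> 'w measure \<Rightarrow> (nat \<Rightarrow> 'w \<Rightarrow> 'a) \<Rightarrow> bool" where
  "deterministic_chain E \<nu> P X \<longleftrightarrow> markov_chain E \<nu> P X \<and> deterministic_kernel E \<nu>"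

end

theory Submission
  imports Defs
begin

text \<open>Put \<open>h = L 1\<^sub>A\<close>, that is \<open>h x = \<nu> x A\<close>. Since \<open>M h = 1\<^sub>A\<close>, for every \<open>y\<close> either \<open>h\<close> or
  \<open>1 - h\<close> has \<open>M\<close>-mean \<open>0\<close> at \<open>y\<close>, so the nonnegative function \<open>h (1 - h)\<close> is annihilated by
  \<open>M\<close>. Applying \<open>L\<close> gives \<open>h (1 - h) = 0\<close>, so every \<open>\<nu> x\<close> takes only the values \<open>0\<close> and \<open>1\<close>.
  As a Lusin space has a countable family of measurable sets separating its points, such a
  measure is a point mass.\<close>

text \<open>The condition runs over ordered pairs, so either point can be isolated from the other by
  a member containing it. Small balls have this property directly, without closing the family under
  complements.\<close>

definition separates_points :: "'a set \<Rightarrow> 'a set set \<Rightarrow> bool" where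
  "separates_points S \<A> \<longleftrightarrow>
     (\<forall>x\<in>S. \<forall>y\<in>S. x \<noteq> y \<longrightarrow> (\<exists>A\<in>\<A>. x \<in> A \<and> y \<notin> A))"

text \<open>Compactness gives total boundedness, hence for every \<open>n\<close> a finite cover by
  balls of radius \<open>1 / (n + 1)\<close>. All these balls together form a countable family with
  members of arbitrarily small diameter around each point.\<close>

lemma compact_metrizable_countable_separating:
  assumes "compact_space K" "metrizable_space K"
  obtains \<U> where "countable \<U>" "\<forall>U\<in>\<U>. openin K U" "separates_points (topspace K) \<U>"
proof -
  from assms(2) obtain S d where ms: "Metric_space S d" and K: "K = Metric_space.mtopology S d"
    by (auto simp: metrizable_space_def)
  interpret Metric_space S d by (rule ms)
  have "mtotally_bounded S"
    using assms(1) K by (simp add: compact_space_eq_mcomplete_mtotally_bounded)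
  then have "\<forall>n. \<exists>C. finite C \<and> C \<subseteq> S \<and> S \<subseteq> (\<Union>x\<in>C. mball x (inverse (real (Suc n))))"
    unfolding mtotally_bounded_def by simp
  then obtain C where fin: "\<And>n. finite (C n)"
      and cov: "\<And>n. S \<subseteq> (\<Union>x\<in>C n. mball x (inverse (real (Suc n))))"
    by metis
  define \<U> where "\<U> = (\<Union>n. (\<lambda>c. mball c (inverse (real (Suc n)))) ` C n)"
  show thesis
  proof (rule that)
    show "countable \<U>"
      unfolding \<U>_def using fin by (intro countable_UN countable_image) (auto intro: countable_finite)
    show "\<forall>U\<in>\<U>. openin K U"
      unfolding \<U>_def K by auto
    show "separates_points (topspace K) \<U>"
      unfolding separates_points_def
    proof (intro ballI impI)
      fix x y assume "x \<in> topspace K" "y \<in> topspace K" "x \<noteq> y"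
      then have x: "x \<in> S" and y: "y \<in> S" and "0 < d x y" by (auto simp: K)
      \<comment> \<open>Two points of a ball of radius \<open>r\<close> are less than
        \<open>2 * r\<close> apart, so with \<open>r\<close> below half of \<open>d x y\<close> no
        ball can contain both \<open>x\<close> and \<open>y\<close>.\<close>
      then obtain n where n: "inverse (real (Suc n)) < d x y / 2"
        using reals_Archimedean[of "d x y / 2"] by auto
      obtain c where c: "c \<in> C n" "x \<in> mball c (inverse (real (Suc n)))"
        using cov x by blast
      have "y \<notin> mball c (inverse (real (Suc n)))"
      proof
        assume "y \<in> mball c (inverse (real (Suc n)))"
        moreover have "d x y \<le> d c x + d c y"
          using triangle[of x c y] c(2) x y commute[of x c] by auto
        ultimately show False using c(2) n by auto
      qed
      with c show "\<exists>U\<in>\<U>. x \<in> U \<and> y \<notin> U"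
        unfolding \<U>_def by blast
    qed
  qed
qed

text \<open>The separating open sets of \<open>K\<close> are pulled back along the isomorphism
  \<open>f\<close>. Their preimages are measurable because \<open>f\<close> is, and still separate
  points because the left inverse \<open>g\<close> makes \<open>f\<close> injective on
  \<open>space E\<close>.\<close>

lemma lusin_space_countable_separating:
  assumes "lusin_space TYPE('b) E"
  obtains \<A> where "countable \<A>" "\<A> \<subseteq> sets E" "separates_points (space E) \<A>"
proof -
  from assms obtain K :: "'b topology" and B where K: "compact_space K" "metrizable_space K"
      and "measurable_isomorphic E (restrict_space (topology_borel K) B)"
    unfolding lusin_space_def by blast
  then obtain f g where f: "f \<in> E \<rightarrow>\<^sub>M restrict_space (topology_borel K) B"
      and gf: "\<And>x. x \<in> space E \<Longrightarrow> g (f x) = x"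
    unfolding measurable_isomorphic_def by blast
  have space_K: "space (topology_borel K) = topspace K"
    unfolding topology_borel_def by (intro space_measure_of) (auto dest: openin_subset)
  have f_top: "f \<in> E \<rightarrow>\<^sub>M topology_borel K"
    using f by (auto simp: measurable_restrict_space2_iff)
  obtain \<U> where \<U>: "countable \<U>" "\<forall>U\<in>\<U>. openin K U" "separates_points (topspace K) \<U>"
    by (rule compact_metrizable_countable_separating[OF K])
  have open_sets: "U \<in> sets (topology_borel K)" if "openin K U" for U
    unfolding topology_borel_def using that
    by (subst sets_measure_of) (auto dest: openin_subset)
  show thesis
  proof (rule that)
    show "countable ((\<lambda>U. f -` U \<inter> space E) ` \<U>)"
      using \<U>(1) by simp
    show "(\<lambda>U. f -` U \<inter> space E) ` \<U> \<subseteq> sets E"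
      using f_top \<U>(2) open_sets by (auto intro: measurable_sets)
    show "separates_points (space E) ((\<lambda>U. f -` U \<inter> space E) ` \<U>)"
      unfolding separates_points_def
    proof (intro ballI impI)
      fix x y assume xy: "x \<in> space E" "y \<in> space E" "x \<noteq> y"
      then have "f x \<noteq> f y" using gf by metis
      moreover have "f x \<in> topspace K" "f y \<in> topspace K"
        using measurable_space[OF f_top] xy space_K by auto
      ultimately obtain U where "U \<in> \<U>" "f x \<in> U" "f y \<notin> U"
        using \<U>(3) unfolding separates_points_def by blast
      with xy show "\<exists>A\<in>(\<lambda>U. f -` U \<inter> space E) ` \<U>. x \<in> A \<and> y \<notin> A"
        by (intro bexI[of _ "f -` U \<inter> space E"]) auto
    qed
  qed
qed

text \<open>Almost every point lies in exactly those members of the family that have measure 1. Two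
  such points are not separated by the family, hence coincide, so the measure is concentrated on a
  single point.\<close>

lemma zero_one_measure_eq_return:
  assumes "prob_space N" and sets_N: "sets N = sets E"
    and \<A>: "countable \<A>" "\<A> \<subseteq> sets E" "separates_points (space E) \<A>"
    and zero_one: "\<And>A. A \<in> sets E \<Longrightarrow> measure N A = 0 \<or> measure N A = 1"
  shows "\<exists>y\<in>space E. N = return E y"
proof -
  interpret prob_space N by fact
  have space_N: "space N = space E"
    using sets_N by (rule sets_eq_imp_space_eq)
  have "AE y in N. y \<in> A \<longleftrightarrow> measure N A = 1" if "A \<in> sets E" for A
  proof (cases "measure N A = 1")
    case True
    then show ?thesis
      using that sets_N prob_eq_1[of A] by simp
  next
    case False
    then have "measure N A = 0" using zero_one[OF that] by simp
    then show ?thesis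
      using that sets_N prob_eq_0[of A] by simp
  qed
  \<comment> \<open>Countability of \<open>\<A>\<close> lets one null set serve all its members at
    once.\<close>
  then have "AE y in N. \<forall>A\<in>\<A>. y \<in> A \<longleftrightarrow> measure N A = 1"
    using \<A>(1,2) by (subst AE_ball_countable) auto
  then have conc: "AE y in N. y \<in> space E \<and> (\<forall>A\<in>\<A>. y \<in> A \<longleftrightarrow> measure N A = 1)"
    using AE_space[of N] space_N by auto
  \<comment> \<open>A property that holds almost everywhere for a probability measure holds at some
    point.\<close>
  then obtain y where y: "y \<in> space E" "\<forall>A\<in>\<A>. y \<in> A \<longleftrightarrow> measure N A = 1"
    using eventually_happens'[OF ae_filter_bot conc] by blast
  have AE_y: "AE z in N. z = y"
    using conc
  proof eventually_elim
    case (elim z)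
    then show ?case
      using \<A>(3) y unfolding separates_points_def by metis
  qed
  have "N = return E y"
  proof (rule measure_eqI)
    show "sets N = sets (return E y)"
      using sets_N by simp
    fix A assume A: "A \<in> sets N"
    show "emeasure N A = emeasure (return E y) A"
    proof (cases "y \<in> A")
      case True
      have "AE z in N. z \<in> A" using AE_y by eventually_elim (simp add: True)
      then show ?thesis
        using A True sets_N emeasure_eq_1_AE by simp
    next
      case False
      have "AE z in N. z \<notin> A" using AE_y by eventually_elim (simp add: False)
      then show ?thesis
        using A False sets_N prob_eq_0[OF A] by (simp add: emeasure_eq_measure)
    qed
  qed
  with y(1) show ?thesis by blast
qed

lemma markov_kernelD:
  assumes "markov_kernel E \<nu>" "x \<in> space E"
  shows "prob_space (\<nu> x)" "sets (\<nu> x) = sets E" "space (\<nu> x) = space E"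
  using measurable_space[of \<nu> E "prob_algebra E" x] assms
  by (auto simp: markov_kernel_def space_prob_algebra dest: sets_eq_imp_space_eq)

lemma Linf_of_real:
  assumes "p \<in> borel_measurable E" "\<And>x. x \<in> space E \<Longrightarrow> \<bar>p x\<bar> \<le> c"
  shows "(\<lambda>x. complex_of_real (p x)) \<in> Linf E"
  using assms unfolding Linf_def bounded_iff by auto

text \<open>The function \<open>f\<close> and its real form \<open>p\<close> need to agree only on
  \<open>space E\<close>, which is the space of \<open>\<nu> x\<close>. This makes the rule
  applicable to images such as \<open>L a\<close> and \<open>M b\<close>, whose values are known
  only there.\<close>

lemma markov_operator_of_real:
  assumes "markov_operator_of E \<nu> L" "f \<in> Linf E" "\<And>z. z \<in> space E \<Longrightarrow> f z = complex_of_real (p z)"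
    and "x \<in> space E"
  shows "L f x = complex_of_real (\<integral>z. p z \<partial>\<nu> x)"
proof -
  have "L f x = (\<integral>z. f z \<partial>\<nu> x)"
    using assms by (auto simp: markov_operator_of_def)
  also have "\<dots> = (\<integral>z. complex_of_real (p z) \<partial>\<nu> x)"
    using assms markov_kernelD(3)[of E \<nu> x]
    by (intro Bochner_Integration.integral_cong) (auto simp: markov_operator_of_def)
  finally show ?thesis by simp
qed

lemma markov_invertible_zero_one:
  assumes L: "markov_operator_of E \<nu> L" and inv: "markov_invertible E L"
    and x: "x \<in> space E" and A: "A \<in> sets E"
  shows "measure (\<nu> x) A = 0 \<or> measure (\<nu> x) A = 1"
proof -
  from inv obtain M \<mu> where M: "markov_operator_of E \<mu> M"
      and M_L: "\<And>f x. f \<in> Linf E \<Longrightarrow> x \<in> space E \<Longrightarrow> M (L f) x = f x"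
      and L_M: "\<And>f x. f \<in> Linf E \<Longrightarrow> x \<in> space E \<Longrightarrow> L (M f) x = f x"
    unfolding markov_invertible_def markov_operator_def by blast
  have kernels: "markov_kernel E \<nu>" "markov_kernel E \<mu>"
    using L M by (auto simp: markov_operator_of_def)
  \<comment> \<open>This is \<open>h\<close> from the idea above, kept real-valued so that integrals
    can be compared by monotonicity.\<close>
  define p where "p z = measure (\<nu> z) A" for z
  have p_meas [measurable]: "p \<in> borel_measurable E"
    using kernels(1) A unfolding p_def markov_kernel_def by measurable
  have p_bounds: "0 \<le> p z" "p z \<le> 1" if "z \<in> space E" for z
    using markov_kernelD(1)[OF kernels(1) that] by (auto simp: p_def prob_space.prob_le_1)
  define a where "a z = complex_of_real (indicator A z)" for z
  have a: "a \<in> Linf E"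
    unfolding a_def using A by (intro Linf_of_real[where c = 1]) (auto simp: indicator_def)
  have La: "L a z = complex_of_real (p z)" if z: "z \<in> space E" for z
    using markov_operator_of_real[OF L a _ z, of "indicator A"] A markov_kernelD[OF kernels(1) z]
    by (simp add: a_def p_def)
  have "(\<lambda>z. complex_of_real (p z)) \<in> Linf E"
    using p_bounds by (intro Linf_of_real[where c = 1]) auto
  then have La_Linf: "L a \<in> Linf E"
    unfolding Linf_def using La by (auto simp: bounded_iff cong: measurable_cong)
  \<comment> \<open>The identity \<open>M (L a) = a\<close> on \<open>space E\<close>, read through
    the kernel \<open>\<mu>\<close> of \<open>M\<close>.\<close>
  have mean_p: "(\<integral>z. p z \<partial>\<mu> y) = indicator A y" if y: "y \<in> space E" for y
    using markov_operator_of_real[OF M La_Linf La y] M_L[OF a y] by (simp add: a_def)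
  define q where "q z = p z * (1 - p z)" for z
  have q_meas [measurable]: "q \<in> borel_measurable E"
    unfolding q_def by measurable
  have q_bounds: "0 \<le> q z" "q z \<le> p z" "q z \<le> 1 - p z" if "z \<in> space E" for z
    using p_bounds[OF that] by (auto simp: q_def mult_left_le mult_right_le_one_le mult_left_le_one_le)
  have mean_q: "(\<integral>z. q z \<partial>\<mu> y) = 0" if y: "y \<in> space E" for y
  proof -
    note \<mu>y = markov_kernelD[OF kernels(2) y]
    interpret prob_space "\<mu> y" by (rule \<mu>y(1))
    have [measurable_cong]: "sets (\<mu> y) = sets E" by (rule \<mu>y(2))
    have p_int: "integrable (\<mu> y) p"
      using p_bounds \<mu>y(3) by (intro integrable_const_bound[where B = 1] AE_I2) auto
    have q_int: "integrable (\<mu> y) q"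
      using q_bounds p_bounds \<mu>y(3)
      by (intro Bochner_Integration.integrable_bound[OF p_int] AE_I2) auto
    \<comment> \<open>The mean of \<open>q\<close> lies below the means of both \<open>p\<close> and
      \<open>1 - p\<close>. The first of these is 0 when \<open>y\<close> is outside
      \<open>A\<close>, the second when \<open>y\<close> is in \<open>A\<close>.\<close>
    have "(\<integral>z. q z \<partial>\<mu> y) \<le> (\<integral>z. p z \<partial>\<mu> y)"
      using q_bounds \<mu>y(3) by (intro integral_mono q_int p_int) auto
    moreover have "(\<integral>z. q z \<partial>\<mu> y) \<le> (\<integral>z. 1 - p z \<partial>\<mu> y)"
      using q_bounds \<mu>y(3) p_int by (intro integral_mono q_int) auto
    moreover have "(\<integral>z. 1 - p z \<partial>\<mu> y) = 1 - (\<integral>z. p z \<partial>\<mu> y)"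
      using p_int by (simp add: prob_space)
    moreover have "0 \<le> (\<integral>z. q z \<partial>\<mu> y)"
      using q_bounds \<mu>y(3) by (intro Bochner_Integration.integral_nonneg) auto
    ultimately show ?thesis
      using mean_p[OF y] by (cases "y \<in> A") auto
  qed
  define b where "b z = complex_of_real (q z)" for z
  have b: "b \<in> Linf E"
    unfolding b_def using q_bounds p_bounds
    by (intro Linf_of_real[where c = 1]) (force intro: order_trans)+
  have Mb: "M b z = complex_of_real 0" if "z \<in> space E" for z
    using markov_operator_of_real[OF M b b_def that] mean_q[OF that] by simp
  then have Mb_Linf: "M b \<in> Linf E"
    unfolding Linf_def by (auto simp: bounded_iff cong: measurable_cong)
  \<comment> \<open>Here the other identity \<open>L (M b) = b\<close> enters: \<open>M b\<close>
    vanishes on \<open>space E\<close>, so \<open>b\<close> does too. Then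
    \<open>p x * (1 - p x) = 0\<close> leaves only the values 0 and 1 for
    \<open>p x\<close>.\<close>
  have "L (M b) x = 0"
    using markov_operator_of_real[OF L Mb_Linf Mb x] by simp
  then have "q x = 0"
    using L_M[OF b x] by (simp add: b_def)
  then show ?thesis
    by (auto simp: q_def p_def)
qed

theorem theorem2p7:
  fixes E :: "'a measure"
    and \<nu> :: "'a \<Rightarrow> 'a measure"
    and L :: "('a \<Rightarrow> complex) \<Rightarrow> ('a \<Rightarrow> complex)"
    and P :: "'w measure"
    and X :: "nat \<Rightarrow> 'w \<Rightarrow> 'a"
  assumes "lusin_space TYPE('b) E"
    and "markov_chain E \<nu> P X"
    and "markov_operator_of E \<nu> L"
    and "markov_invertible E L"
  shows "deterministic_chain E \<nu> P X"
proof -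
  obtain \<A> where \<A>: "countable \<A>" "\<A> \<subseteq> sets E" "separates_points (space E) \<A>"
    using lusin_space_countable_separating[OF assms(1)] .
  have kernel: "markov_kernel E \<nu>"
    using assms(2) by (simp add: markov_chain_def)
  have "\<exists>y\<in>space E. \<nu> x = return E y" if x: "x \<in> space E" for x
    using markov_kernelD(1,2)[OF kernel x] \<A> markov_invertible_zero_one[OF assms(3,4) x]
    by (rule zero_one_measure_eq_return)
  then show ?thesis
    using assms(2) by (simp add: deterministic_chain_def deterministic_kernel_def)
qed

end
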